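(* Let $X$ be a Polish space, let $Y$ be a metric space, let $\alpha$ be a non-principal ultrafilter on $\mathbb{N}$, and suppose that $(f_n)_{n\in\mathbb{N}}$ is a sequence of Borel functions from $X$ into $Y$ converging pointwise to the Borel function $f:X\to Y$ along $\alpha$ (i.e. $\lim_{n\to\alpha}f_n(x)=f(x)$ for every $x\in X$). If $\alpha$ is selective, then there exists $N\in\alpha$ such that $$\lim_{\substack{n\to\infty\\ n\in N}}f_n(x)=f(x)\qquad\text{for all }x\in X.$$
   Context: A non-principal ultrafilter $\alpha$ on $\mathbb{N}$ is selective (Ramsey) if for every partition $\{A_n:n\in\mathbb{N}\}$ of $\mathbb{N}$ with $A_n\notin\alpha$ for all $n$, there is $X\in\alpha$ such that $|X\cap A_n|=1$ for each $n\in\mathbb{N}$. *)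

theory Defs
  imports "HOL-Analysis.Analysis"
begin

text \<open>A (proper) ultrafilter is represented as a filter on the type; a set \<open>N\<close> belongs to it
  iff \<open>\<forall>\<^sub>F n in \<alpha>. n \<in> N\<close>.\<close>

definition ultrafilter :: "'a filter \<Rightarrow> bool" where
  "ultrafilter \<alpha> \<longleftrightarrow>
     \<alpha> \<noteq> bot \<and> (\<forall>N. (\<forall>\<^sub>F n in \<alpha>. n \<in> N) \<or> (\<forall>\<^sub>F n in \<alpha>. n \<in> - N))"

definition nonprincipal_ultrafilter :: "'a filter \<Rightarrow> bool" where
  "nonprincipal_ultrafilter \<alpha> \<longleftrightarrow> ultrafilter \<alpha> \<and> (\<forall>S. \<alpha> \<noteq> principal S)"

definition selective :: "nat filter \<Rightarrow> bool" where
  "selective \<alpha> \<longleftrightarrow>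
     (\<forall>A :: nat \<Rightarrow> nat set.
        disjoint_family A \<longrightarrow> (\<Union>n. A n) = UNIV \<longrightarrow> (\<forall>n. A n \<noteq> {}) \<longrightarrow>
        (\<forall>n. \<not> (\<forall>\<^sub>F k in \<alpha>. k \<in> A n)) \<longrightarrow>
        (\<exists>X. (\<forall>\<^sub>F k in \<alpha>. k \<in> X) \<and> (\<forall>n. card (X \<inter> A n) = 1)))"

end

theory Submission
  imports Defs
begin

text \<open>For \<open>\<epsilon> > 0\<close> the sets \<open>C n = {x. dist (f n x) (g x) \<ge> \<epsilon>}\<close> are Borel; this needs
  that a Borel function on a Polish space has separable range. Otherwise there would be a Borel map
  with uncountable range for which the preimage of every set is Borel. By the perfect set
  theorem that range has at least continuum many points, hence more subsets than there are analytic
  sets.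

  Write the \<open>C n\<close> as projections of closed sets. Points together with their witnesses then form
  a closed subset of a Polish space, on which the set of witnessed indices \<open>n\<close> depends lower
  semicontinuously on the point and never belongs to \<open>\<alpha>\<close>. Call an open set bad if no member of
  \<open>\<alpha>\<close> is almost disjoint from all index sets arising in it. Since \<open>\<alpha>\<close> is a P-point, for
  \<open>\<alpha>\<close>-almost all \<open>n\<close> a bad set contains a smaller bad set on which \<open>n\<close> is always witnessed. If
  the whole space were bad, selectivity would give a member of \<open>\<alpha>\<close> along which this can be
  iterated, and the limit point would have an index set in \<open>\<alpha>\<close>. So some \<open>N \<in> \<alpha>\<close> meets each
  \<open>{n. x \<in> C n}\<close> in a finite set, and a pseudo-intersection over \<open>\<epsilon> = 1/k\<close> is the required set.\<close>

subsection \<open>Selective ultrafilters\<close>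

lemma ultrafilter_not_eventually:
  assumes "ultrafilter \<alpha>"
  shows "\<not> (\<forall>\<^sub>F n in \<alpha>. P n) \<longleftrightarrow> (\<forall>\<^sub>F n in \<alpha>. \<not> P n)"
proof
  assume "\<not> (\<forall>\<^sub>F n in \<alpha>. P n)"
  moreover have "(\<forall>\<^sub>F n in \<alpha>. n \<in> {n. P n}) \<or> (\<forall>\<^sub>F n in \<alpha>. n \<in> - {n. P n})"
    using assms unfolding ultrafilter_def by blast
  ultimately show "\<forall>\<^sub>F n in \<alpha>. \<not> P n" by auto
next
  assume *: "\<forall>\<^sub>F n in \<alpha>. \<not> P n"
  show "\<not> (\<forall>\<^sub>F n in \<alpha>. P n)"
  proof
    assume "\<forall>\<^sub>F n in \<alpha>. P n"
    with * have "\<forall>\<^sub>F n in \<alpha>. False" by eventually_elim simp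
    then show False using assms by (simp add: ultrafilter_def trivial_limit_def)
  qed
qed

lemma nonprincipal_ultrafilter_eventually_neq:
  assumes "nonprincipal_ultrafilter \<alpha>"
  shows "\<forall>\<^sub>F n in \<alpha>. n \<noteq> k"
proof (rule ccontr)
  have u: "ultrafilter \<alpha>" using assms by (simp add: nonprincipal_ultrafilter_def)
  assume "\<not> (\<forall>\<^sub>F n in \<alpha>. n \<noteq> k)"
  then have k: "\<forall>\<^sub>F n in \<alpha>. n = k"
    using ultrafilter_not_eventually[OF u] by fastforce
  have "eventually P \<alpha> \<longleftrightarrow> eventually P (principal {k})" for P
  proof
    assume "eventually P \<alpha>"
    show "eventually P (principal {k})"
    proof (rule ccontr)
      assume "\<not> eventually P (principal {k})"
      then have "\<not> P k" by (simp add: eventually_principal)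
      from \<open>eventually P \<alpha>\<close> k have "\<forall>\<^sub>F n in \<alpha>. False"
        by eventually_elim (use \<open>\<not> P k\<close> in auto)
      then show False using u by (simp add: ultrafilter_def trivial_limit_def)
    qed
  next
    assume "eventually P (principal {k})"
    then have "P k" by (simp add: eventually_principal)
    with k show "eventually P \<alpha>" by (auto elim: eventually_mono)
  qed
  then have "\<alpha> = principal {k}" by (simp add: filter_eq_iff)
  then show False using assms by (simp add: nonprincipal_ultrafilter_def)
qed

lemma nonprincipal_ultrafilter_eventually_finite:
  assumes "nonprincipal_ultrafilter \<alpha>" "finite S"
  shows "\<forall>\<^sub>F n in \<alpha>. n \<notin> S"
proof -
  have "\<forall>\<^sub>F n in \<alpha>. \<forall>k\<in>S. n \<noteq> k"
    using assms nonprincipal_ultrafilter_eventually_neq by (intro eventually_ball_finite) auto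
  then show ?thesis by (rule eventually_mono) auto
qed

lemma nonprincipal_ultrafilter_imp_infinite:
  assumes "nonprincipal_ultrafilter \<alpha>" "\<forall>\<^sub>F n in \<alpha>. n \<in> S"
  shows "infinite S"
proof
  assume "finite S"
  from nonprincipal_ultrafilter_eventually_finite[OF assms(1) this] assms(2)
  have "\<forall>\<^sub>F n in \<alpha>. False" by eventually_elim simp
  then show False
    using assms(1) by (simp add: nonprincipal_ultrafilter_def ultrafilter_def trivial_limit_def)
qed

text \<open>The nonempty fibres of \<open>h\<close> partition \<open>nat\<close> into sets outside
  \<alpha>, and a selector for this partition meets each fibre once.\<close>

lemma selective_inj_on:
  fixes \<alpha> :: "nat filter" and h :: "nat \<Rightarrow> nat"
  assumes np: "nonprincipal_ultrafilter \<alpha>" and sel: "selective \<alpha>"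
    and h: "\<And>m. \<forall>\<^sub>F k in \<alpha>. h k \<noteq> m"
  obtains X where "\<forall>\<^sub>F k in \<alpha>. k \<in> X" "inj_on h X"
proof -
  have u: "ultrafilter \<alpha>" using np by (simp add: nonprincipal_ultrafilter_def)
  have inf: "infinite (range h)"
  proof
    assume "finite (range h)"
    then have "\<forall>\<^sub>F k in \<alpha>. \<forall>m\<in>range h. h k \<noteq> m"
      using h by (intro eventually_ball_finite) auto
    then have "\<forall>\<^sub>F k in \<alpha>. False" by (rule eventually_mono) auto
    then show False using u by (simp add: ultrafilter_def trivial_limit_def)
  qed
  \<comment> \<open>Enumerating the range leaves out the empty fibres. The range is infinite because
    finitely many sets outside \<alpha> cannot cover \<open>nat\<close>.\<close>
  define A where "A n = h -` {enumerate (range h) n}" for n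
  have "disjoint_family A"
    using enumerate_mono[OF _ inf] unfolding disjoint_family_on_def A_def
    by (auto simp: neq_iff) (metis less_irrefl)+
  moreover have "(\<Union>n. A n) = UNIV"
    using enumerate_Ex[OF inf] unfolding A_def by auto (metis rangeI)
  moreover have "A n \<noteq> {}" for n
    using enumerate_in_set[OF inf, of n] unfolding A_def by auto
  moreover have "\<not> (\<forall>\<^sub>F k in \<alpha>. k \<in> A n)" for n
    using h[of "enumerate (range h) n"] ultrafilter_not_eventually[OF u, of "\<lambda>k. k \<in> A n"]
    by (simp add: A_def)
  ultimately obtain X where X: "\<forall>\<^sub>F k in \<alpha>. k \<in> X" "\<And>n. card (X \<inter> A n) = 1"
    using sel unfolding selective_def by blast
  have "inj_on h X"
  proof (rule inj_onI)
    fix i j assume ij: "i \<in> X" "j \<in> X" "h i = h j"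
    obtain n where "enumerate (range h) n = h i" using enumerate_Ex[OF inf] by blast
    then have "i \<in> X \<inter> A n" "j \<in> X \<inter> A n" using ij by (auto simp: A_def)
    then show "i = j" using X(2)[of n] by (metis card_1_singletonE singletonD)
  qed
  with X(1) that show thesis by blast
qed

text \<open>The P-point property. Grade each \<open>k\<close> by the first \<open>B n\<close> that
  misses it. Where the grade is injective, only finitely many points have grade at most
  \<open>Suc n\<close>, and every point outside \<open>B n\<close> is among these.\<close>

lemma selective_pseudo_intersection:
  fixes \<alpha> :: "nat filter" and B :: "nat \<Rightarrow> nat set"
  assumes np: "nonprincipal_ultrafilter \<alpha>" and sel: "selective \<alpha>"
    and B: "\<And>n. \<forall>\<^sub>F k in \<alpha>. k \<in> B n"
  obtains X where "\<forall>\<^sub>F k in \<alpha>. k \<in> X" "\<And>n. finite (X - B n)"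
proof (cases "\<forall>\<^sub>F k in \<alpha>. k \<in> (\<Inter>n. B n)")
  case True
  have "finite ((\<Inter>n. B n) - B m)" for m
    by (rule finite_subset[of _ "{}"]) auto
  with True that show thesis by blast
next
  case False
  have u: "ultrafilter \<alpha>" using np by (simp add: nonprincipal_ultrafilter_def)
  \<comment> \<open>Grade 0 is kept for the points lying in every \<open>B n\<close>; by the case
    assumption they form a set outside \<alpha>.\<close>
  define h where "h k = (if k \<in> (\<Inter>n. B n) then 0 else Suc (LEAST n. k \<notin> B n))" for k
  have "\<forall>\<^sub>F k in \<alpha>. h k \<noteq> m" for m
  proof (cases m)
    case 0
    from False have "\<forall>\<^sub>F k in \<alpha>. k \<notin> (\<Inter>n. B n)"
      using ultrafilter_not_eventually[OF u] by blast
    then show ?thesis by (rule eventually_mono) (auto simp: h_def 0)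
  next
    case (Suc n)
    from B[of n] show ?thesis
    proof (rule eventually_mono)
      fix k assume "k \<in> B n"
      have "k \<notin> B (LEAST n. k \<notin> B n)" if "k \<notin> (\<Inter>n. B n)"
        using that LeastI_ex[of "\<lambda>n. k \<notin> B n"] by auto
      then show "h k \<noteq> m" using \<open>k \<in> B n\<close> by (auto simp: h_def Suc)
    qed
  qed
  then obtain X where X: "\<forall>\<^sub>F k in \<alpha>. k \<in> X" "inj_on h X"
    using selective_inj_on[OF np sel] by blast
  have "finite (X - B n)" for n
  proof -
    have "h ` (X - B n) \<subseteq> {..Suc n}"
      by (auto simp: h_def intro: Least_le)
    then have "finite (h ` (X - B n))" by (rule finite_subset) simp
    then show ?thesis
      by (rule finite_imageD) (rule inj_on_subset[OF X(2)], auto)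
  qed
  with X(1) that show thesis by blast
qed

text \<open>A pseudo-intersection \<open>X\<close> leaves \<open>B i\<close> only below some bound
  \<open>w i\<close>. Cut \<open>nat\<close> into intervals so long that skipping a whole one passes
  the bounds of all points before it; then keep at most one point per interval, using intervals of
  one parity only.\<close>

lemma selective_diagonal:
  fixes \<alpha> :: "nat filter" and B :: "nat \<Rightarrow> nat set"
  assumes np: "nonprincipal_ultrafilter \<alpha>" and sel: "selective \<alpha>"
    and B: "\<And>n. \<forall>\<^sub>F k in \<alpha>. k \<in> B n"
  obtains N where "\<forall>\<^sub>F k in \<alpha>. k \<in> N" "\<And>i j. i \<in> N \<Longrightarrow> j \<in> N \<Longrightarrow> i < j \<Longrightarrow> j \<in> B i"
proof -
  have u: "ultrafilter \<alpha>" using np by (simp add: nonprincipal_ultrafilter_def)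
  obtain X where X: "\<forall>\<^sub>F k in \<alpha>. k \<in> X" "\<And>n. finite (X - B n)"
    by (rule selective_pseudo_intersection[where B = B, OF np sel B]) blast
  have "\<exists>m. \<forall>j\<in>X - B i. j < m" for i
    using X(2)[of i] unfolding finite_nat_set_iff_bounded .
  then have "\<exists>w. \<forall>i. \<forall>j\<in>X - B i. j < w i" by (intro choice allI)
  then obtain w where w: "\<And>i j. j \<in> X - B i \<Longrightarrow> j < w i" by blast
  \<comment> \<open>\<open>Suc n\<close> makes \<open>a\<close> strictly increasing; the sum
    dominates each \<open>w i\<close> with \<open>i \<le> n\<close>.\<close>
  define v where "v n = Suc n + (\<Sum>i\<le>n. w i)" for n
  have vu: "w i \<le> v n" if "i \<le> n" for i n
    using that member_le_sum[of i "{..n}" w] by (auto simp: v_def)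
  define a where "a n = (v ^^ n) 0" for n
  have a_Suc: "a (Suc n) = v (a n)" for n by (simp add: a_def)
  have "strict_mono a"
    by (rule strict_monoI_Suc) (simp add: a_Suc v_def)
  have ex: "k < a (Suc k)" for k
    using seq_suble[OF \<open>strict_mono a\<close>, of "Suc k"] by simp
  \<comment> \<open>\<open>I k\<close> indexes the interval containing \<open>k\<close>: its right
    end \<open>a (I k)\<close> is the first \<open>a i\<close> beyond \<open>k\<close>.\<close>
  define I where "I k = (LEAST i. k < a i)" for k
  have I1: "k < a (I k)" for k
    unfolding I_def using ex by (rule LeastI)
  have I2: "a i \<le> k" if "i < I k" for i k
    using not_less_Least[OF that[unfolded I_def]] by simp
  have "\<forall>\<^sub>F k in \<alpha>. I k \<noteq> m" for m
    using nonprincipal_ultrafilter_eventually_finite[OF np, of "{..<a m}"] I1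
    by (auto elim!: eventually_mono)
  then obtain Y where Y: "\<forall>\<^sub>F k in \<alpha>. k \<in> Y" "inj_on I Y"
    using selective_inj_on[OF np sel] by blast
  have "\<exists>b. \<forall>\<^sub>F k in \<alpha>. even (I k) = b"
    using ultrafilter_not_eventually[OF u, of "\<lambda>k. even (I k)"]
    by (cases "\<forall>\<^sub>F k in \<alpha>. even (I k)") (rule exI[of _ True], simp, rule exI[of _ False], simp)
  then obtain b where b: "\<forall>\<^sub>F k in \<alpha>. even (I k) = b" by blast
  let ?N = "{k \<in> X \<inter> Y. even (I k) = b}"
  have "\<forall>\<^sub>F k in \<alpha>. k \<in> ?N"
    using X(1) Y(1) b by eventually_elim simp
  moreover have "j \<in> B i" if ij: "i \<in> ?N" "j \<in> ?N" "i < j" for i j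
  proof -
    have "I i \<le> I j"
      unfolding I_def[of i] by (rule Least_le) (use I1[of j] ij in simp)
    moreover have "I i \<noteq> I j" using ij Y(2) by (auto dest: inj_onD)
    moreover have "I j \<noteq> Suc (I i)" using ij by auto
    \<comment> \<open>A whole interval lies between \<open>i\<close> and \<open>j\<close>, so
      \<open>j\<close> is at least \<open>v (a (I i))\<close>, which dominates \<open>w i\<close>
      because \<open>i < a (I i)\<close>.\<close>
    ultimately have "Suc (I i) < I j" by simp
    from I2[OF this] have "v (a (I i)) \<le> j" by (simp add: a_Suc)
    with vu[of i "a (I i)"] I1[of i] have "w i \<le> j" by simp
    then show ?thesis using w[of j i] ij by (auto simp: not_less[symmetric])
  qed
  ultimately show thesis using that by blast
qed

section \<open>Shrinking open sets in complete metric spaces\<close>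

lemma shrinking_basis_element:
  fixes U :: "'a::metric_space set"
  assumes B: "topological_basis B" and "open U" "z \<in> U" "0 < e"
  obtains V where "V \<in> B" "z \<in> V" "closure V \<subseteq> U" "\<And>x y. x \<in> V \<Longrightarrow> y \<in> V \<Longrightarrow> dist x y < e"
proof -
  obtain d where d: "d > 0" "cball z d \<subseteq> U"
    using \<open>open U\<close> \<open>z \<in> U\<close> open_contains_cball by blast
  have "open (ball z (min d (e/2)))" "z \<in> ball z (min d (e/2))"
    using \<open>0 < e\<close> d by auto
  then obtain V where V: "V \<in> B" "z \<in> V" "V \<subseteq> ball z (min d (e/2))"
    using topological_basisE[OF B] by metis
  have "closure V \<subseteq> cball z d"
    using V(3) by (intro closure_minimal) auto
  moreover have "dist x y < e" if "x \<in> V" "y \<in> V" for x y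
    using subsetD[OF V(3) that(1)] subsetD[OF V(3) that(2)]
    by (intro dist_triangle_half_r[of z x e y]) simp_all
  ultimately show thesis using that[of V] V d by simp
qed

text \<open>Cantor's intersection argument: points chosen in \<open>K \<inter> V i\<close> form a
  Cauchy sequence, whose limit lies in the closure of each set and hence in the set before it. The
  diameter bound starts with \<open>V 1\<close>, so the whole space may serve as
  \<open>V 0\<close>.\<close>

lemma nested_sets_limit:
  fixes K :: "'a::complete_space set"
  assumes "closed K" and ne: "\<And>i. K \<inter> V i \<noteq> {}"
    and nest: "\<And>i. closure (V (Suc i)) \<subseteq> V i"
    and small: "\<And>i x y. x \<in> V (Suc i) \<Longrightarrow> y \<in> V (Suc i) \<Longrightarrow> dist x y < 1 / Suc i"
  obtains z where "z \<in> K" "\<And>i. z \<in> V i"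
proof -
  have "\<forall>i. \<exists>x. x \<in> K \<inter> V i" using ne by blast
  then obtain s where s: "\<And>i. s i \<in> K \<inter> V i" by metis
  have "V (Suc i) \<subseteq> V i" for i using nest closure_subset by blast
  then have dec: "V j \<subseteq> V i" if "i \<le> j" for i j
    using that by (rule lift_Suc_antimono_le)
  have "Cauchy s"
  proof (rule metric_CauchyI)
    fix e :: real assume "0 < e"
    then obtain n where n: "1 / Suc n < e" using nat_approx_posE by blast
    have "dist (s i) (s j) < e" if "i \<ge> Suc n" "j \<ge> Suc n" for i j
      using small[of "s i" n "s j"] s dec that n by (meson IntD2 less_trans subsetD)
    then show "\<exists>M. \<forall>m\<ge>M. \<forall>n\<ge>M. dist (s m) (s n) < e" by blast
  qed
  then obtain z where z: "s \<longlonglongrightarrow> z" using Cauchy_convergent convergent_def by blast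
  have "z \<in> K" using \<open>closed K\<close> s z closed_sequentially by blast
  moreover have "z \<in> V i" for i
  proof -
    have "s n \<in> closure (V (Suc i))" if "n \<ge> Suc i" for n
      using s dec[OF that] closure_subset by blast
    then have "z \<in> closure (V (Suc i))"
      using z by (intro Lim_in_closed_set[OF closed_closure])
        (auto simp: eventually_sequentially)
    then show ?thesis using nest by blast
  qed
  ultimately show thesis using that by blast
qed

text \<open>If the conclusion fails, shrinking bad sets force the elements of some set in \<alpha>
  one by one into \<open>\<phi> z\<close> for a limit point \<open>z\<close> of \<open>K\<close>,
  against \<open>null\<close>. By \<open>op\<close>, an index present at one point is present on a
  whole neighbourhood.\<close>

lemma selective_almost_disjoint:
  fixes \<alpha> :: "nat filter" and \<phi> :: "'a::{complete_space,second_countable_topology} \<Rightarrow> nat set"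
  assumes np: "nonprincipal_ultrafilter \<alpha>" and sel: "selective \<alpha>"
    and "closed K" and op: "\<And>n. open {z. n \<in> \<phi> z}"
    and null: "\<And>z. z \<in> K \<Longrightarrow> \<not> (\<forall>\<^sub>F n in \<alpha>. n \<in> \<phi> z)"
  obtains N where "\<forall>\<^sub>F n in \<alpha>. n \<in> N" "\<And>z. z \<in> K \<Longrightarrow> finite (N \<inter> \<phi> z)"
proof -
  have u: "ultrafilter \<alpha>" using np by (simp add: nonprincipal_ultrafilter_def)
  obtain B :: "'a set set" where B: "countable B" "topological_basis B"
    using ex_countable_basis by blast
  have "B \<noteq> {}" using B(2) topological_basisE open_UNIV UNIV_I by (metis empty_iff)
  define bad where "bad U \<longleftrightarrow> open U \<and>
    \<not> (\<exists>N. (\<forall>\<^sub>F n in \<alpha>. n \<in> N) \<and> (\<forall>z\<in>K \<inter> U. finite (N \<inter> \<phi> z)))" for U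
  \<comment> \<open>\<open>V\<close> is an admissible answer, in round \<open>i\<close> at position
    \<open>U\<close>, to the move \<open>n\<close>.\<close>
  define step where "step U i n V \<longleftrightarrow> bad V \<and> closure V \<subseteq> U \<and>
    (\<forall>x\<in>V. \<forall>y\<in>V. dist x y < 1 / Suc i) \<and> (\<forall>z\<in>V. n \<in> \<phi> z)" for U :: "'a set" and i n :: nat and V
  have key: "\<forall>\<^sub>F n in \<alpha>. \<exists>V. step U i n V" if "bad U" for U i
  proof (rule ccontr)
    assume "\<not> (\<forall>\<^sub>F n in \<alpha>. \<exists>V. step U i n V)"
    then have M: "\<forall>\<^sub>F n in \<alpha>. \<not> (\<exists>V. step U i n V)"
      using ultrafilter_not_eventually[OF u] by blast
    \<comment> \<open>\<open>G V\<close> will witness that a basic set \<open>V\<close> is not bad;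
      for all other \<open>V\<close> the default is \<open>UNIV\<close>.\<close>
    have "\<exists>N. (\<forall>\<^sub>F n in \<alpha>. n \<in> N) \<and> (V \<in> B \<longrightarrow> \<not> bad V \<longrightarrow> (\<forall>z\<in>K \<inter> V. finite (N \<inter> \<phi> z)))" for V
      using topological_basis_open[OF B(2)] unfolding bad_def
      by (cases "V \<in> B \<and> \<not> bad V") (auto simp: bad_def intro: exI[of _ UNIV])
    then obtain G where G: "\<And>V. \<forall>\<^sub>F n in \<alpha>. n \<in> G V"
      "\<And>V z. V \<in> B \<Longrightarrow> \<not> bad V \<Longrightarrow> z \<in> K \<Longrightarrow> z \<in> V \<Longrightarrow> finite (G V \<inter> \<phi> z)"
      by (metis IntI)
    obtain N where N: "\<forall>\<^sub>F n in \<alpha>. n \<in> N" "\<And>m. finite (N - G (from_nat_into B m))"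
      using selective_pseudo_intersection[OF np sel, of "\<lambda>m. G (from_nat_into B m)"] G(1) by blast
    let ?N = "{n \<in> N. \<not> (\<exists>V. step U i n V)}"
    have "\<forall>\<^sub>F n in \<alpha>. n \<in> ?N" using N(1) M by eventually_elim simp
    moreover have "finite (?N \<inter> \<phi> z)" if z: "z \<in> K \<inter> U" for z
    proof (cases "\<exists>V\<in>B. \<not> bad V \<and> z \<in> V")
      case True
      then obtain V where V: "V \<in> B" "\<not> bad V" "z \<in> V" by blast
      obtain m where m: "from_nat_into B m = V"
        using from_nat_into_surj[OF B(1) V(1)] by blast
      have "?N \<inter> \<phi> z \<subseteq> (N - G V) \<union> (G V \<inter> \<phi> z)" by auto
      moreover have "finite \<dots>" using N(2)[of m] m G(2)[OF V(1,2) _ V(3)] z by simp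
      ultimately show ?thesis by (rule finite_subset)
    next
      \<comment> \<open>Every basic neighbourhood of \<open>z\<close> is bad, so each
        \<open>n\<close> in \<open>\<phi> z\<close> has an answer and is thereby excluded from
        \<open>?N\<close>.\<close>
      case False
      have "n \<notin> ?N" if n: "n \<in> \<phi> z" for n
      proof -
        have "open (U \<inter> {z. n \<in> \<phi> z})" using \<open>bad U\<close> op by (auto simp: bad_def)
        moreover have "z \<in> U \<inter> {z. n \<in> \<phi> z}" using z n by simp
        ultimately obtain V where V: "V \<in> B" "z \<in> V" "closure V \<subseteq> U \<inter> {z. n \<in> \<phi> z}"
          "\<And>x y. x \<in> V \<Longrightarrow> y \<in> V \<Longrightarrow> dist x y < 1 / Suc i"
          using shrinking_basis_element[OF B(2), of "U \<inter> {z. n \<in> \<phi> z}" z "1 / Suc i"]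
          by (metis of_nat_0_less_iff zero_less_Suc zero_less_divide_1_iff)
        moreover have "bad V" using False V by blast
        ultimately have "step U i n V" using closure_subset[of V] by (auto simp: step_def)
        then show ?thesis by blast
      qed
      then have "?N \<inter> \<phi> z = {}" by blast
      then show ?thesis by simp
    qed
    ultimately show False using \<open>bad U\<close> unfolding bad_def by blast
  qed
  show thesis
  proof (cases "bad UNIV")
    case False
    then show ?thesis using that unfolding bad_def by auto
  next
    case True
    \<comment> \<open>the bad set reached after the moves in \<open>s\<close>, most recent move first\<close>
    define st where "st = rec_list UNIV (\<lambda>n s U. SOME V. step U (length s) n V)"
    have st_Nil: "st [] = UNIV" and st_Cons: "st (n # s) = (SOME V. step (st s) (length s) n V)" for n s
      by (simp_all add: st_def)
    define A where "A s = {n. \<exists>V. step (st s) (length s) n V}" for s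
    have A: "\<forall>\<^sub>F n in \<alpha>. n \<in> A s" if "bad (st s)" for s
      using key[OF that] by (simp add: A_def)
    \<comment> \<open>\<open>D m\<close> collects the good moves for all bad positions with moves up
      to \<open>m\<close>. Distinctness leaves only finitely many such positions, so
      \<open>D m\<close> belongs to \<alpha>.\<close>
    define D where "D m = (\<Inter>s\<in>{s. set s \<subseteq> {..m} \<and> distinct s \<and> bad (st s)}. A s)" for m
    have "finite {s. set s \<subseteq> {..m} \<and> distinct s \<and> bad (st s)}" for m
      by (rule finite_subset[OF _ finite_subset_distinct[of "{..m}"]]) auto
    then have "\<forall>\<^sub>F n in \<alpha>. n \<in> D m" for m
      unfolding D_def INT_iff using A by (intro eventually_ball_finite) auto
    then obtain N where N: "\<forall>\<^sub>F k in \<alpha>. k \<in> N"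
      "\<And>i j. i \<in> N \<Longrightarrow> j \<in> N \<Longrightarrow> i < j \<Longrightarrow> j \<in> D i"
      using selective_diagonal[OF np sel] by blast
    \<comment> \<open>No earlier element of \<open>N\<close> controls the first move, so
      \<open>A []\<close> is imposed separately.\<close>
    define N' where "N' = N \<inter> A []"
    have N': "\<forall>\<^sub>F k in \<alpha>. k \<in> N'"
      using eventually_conj[OF N(1) A[of "[]"]] True by (simp add: N'_def st_Nil)
    have inf: "infinite N'" by (rule nonprincipal_ultrafilter_imp_infinite[OF np N'])
    define m where "m = enumerate N'"
    have m_less: "m i < m j" if "i < j" for i j
      unfolding m_def by (rule enumerate_mono[OF that inf])
    have m_in: "m i \<in> N" for i using enumerate_in_set[OF inf, of i] by (simp add: m_def N'_def)
    define s where "s = rec_nat [] (\<lambda>i t. m i # t)"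
    have s_0: "s 0 = []" and s_Suc: "s (Suc i) = m i # s i" for i by (simp_all add: s_def)
    have len: "length (s i) = i" for i by (induction i) (simp_all add: s_0 s_Suc)
    have set_s: "set (s i) = m ` {..<i}" for i
      by (induction i) (auto simp: s_0 s_Suc lessThan_Suc)
    have dist_s: "distinct (s i)" for i
      by (induction i) (auto simp: s_0 s_Suc set_s dest: m_less)
    have stepI: "step (st (s i)) i (m i) (st (s (Suc i)))" if "m i \<in> A (s i)" for i
      using that unfolding s_Suc st_Cons len A_def by (auto intro: someI_ex)
    \<comment> \<open>The position \<open>s (Suc i)\<close> is among those entering
      \<open>D (m i)\<close>, and diagonality puts the next move \<open>m (Suc i)\<close> into
      \<open>D (m i)\<close>.\<close>
    have play: "bad (st (s i)) \<and> m i \<in> A (s i)" for i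
    proof (induction i)
      case 0
      have "m 0 \<in> N'" unfolding m_def by (rule enumerate_in_set[OF inf])
      then show ?case using True by (simp add: s_0 st_Nil N'_def)
    next
      case (Suc i)
      then have "bad (st (s (Suc i)))" using stepI by (auto simp: step_def)
      moreover have "set (s (Suc i)) \<subseteq> {..m i}"
        using m_less by (auto simp: s_Suc set_s less_imp_le)
      moreover have "m (Suc i) \<in> D (m i)" using N(2) m_in m_less by simp
      ultimately show ?case using dist_s unfolding D_def by blast
    qed
    have step': "step (st (s i)) i (m i) (st (s (Suc i)))" for i using play stepI by blast
    have ne: "K \<inter> st (s i) \<noteq> {}" for i
    proof
      assume "K \<inter> st (s i) = {}"
      then have "\<not> bad (st (s i))" unfolding bad_def by (auto intro!: exI[of _ UNIV])
      then show False using play by blast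
    qed
    obtain z where z: "z \<in> K" "\<And>i. z \<in> st (s i)"
    proof (rule nested_sets_limit[OF \<open>closed K\<close> ne])
      show "closure (st (s (Suc i))) \<subseteq> st (s i)" for i using step' by (simp add: step_def)
      show "dist x y < 1 / Suc i" if "x \<in> st (s (Suc i))" "y \<in> st (s (Suc i))" for i x y
        using step'[of i] that by (simp add: step_def)
    qed blast
    have "m i \<in> \<phi> z" for i using step'[of i] z(2)[of "Suc i"] by (simp add: step_def)
    then have "N' \<subseteq> \<phi> z" using enumerate_Ex[OF inf] unfolding m_def by (metis subsetI)
    then have "\<forall>\<^sub>F n in \<alpha>. n \<in> \<phi> z" using N' by (auto elim: eventually_mono)
    with null[OF z(1)] show ?thesis by blast
  qed
qed

subsection \<open>Analytic sets\<close>

text \<open>The Polish space of witnesses is \<open>nat \<Rightarrow> real\<close> instead of the Baire space because \<open>nat\<close> is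
  no instance of \<open>metric_space\<close>.\<close>

definition analytic :: "'a::topological_space set \<Rightarrow> bool" where
  "analytic C \<longleftrightarrow> (\<exists>F :: ('a \<times> (nat \<Rightarrow> real)) set. closed F \<and> C = fst ` F)"

lemma analyticI: "closed F \<Longrightarrow> C = fst ` F \<Longrightarrow> analytic C"
  for F :: "('a::topological_space \<times> (nat \<Rightarrow> real)) set"
  unfolding analytic_def by blast

lemma closed_imp_analytic:
  assumes "closed C" shows "analytic C"
proof (rule analyticI)
  show "closed (C \<times> (UNIV :: (nat \<Rightarrow> real) set))" using assms by (intro closed_Times) auto
qed auto

text \<open>The witness in coordinate 0 is the reciprocal of the distance to the complement.
  \<open>UNIV\<close> is treated apart because \<open>infdist\<close> to the empty set is 0.\<close>

lemma open_imp_analytic: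
  fixes U :: "'a::metric_space set"
  assumes "open U" shows "analytic U"
proof (cases "U = UNIV")
  case True
  then show ?thesis using closed_imp_analytic[of UNIV] by simp
next
  case False
  let ?F = "{p :: 'a \<times> (nat \<Rightarrow> real). infdist (fst p) (- U) * snd p 0 = 1}"
  have iff: "x \<in> U \<longleftrightarrow> infdist x (- U) \<noteq> 0" for x
    using in_closed_iff_infdist_zero[of "- U" x] assms False by auto
  show ?thesis
  proof (rule analyticI)
    have "continuous_on UNIV (\<lambda>p :: 'a \<times> (nat \<Rightarrow> real). snd p 0)"
      by (rule continuous_on_product_then_coordinatewise) (intro continuous_on_snd continuous_on_id)
    then show "closed ?F"
      by (intro closed_Collect_eq continuous_intros)
    show "U = fst ` ?F"
    proof (intro set_eqI iffI)
      fix x assume "x \<in> U"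
      then have "(x, \<lambda>_. 1 / infdist x (- U)) \<in> ?F" by (simp add: iff)
      then show "x \<in> fst ` ?F" by (rule image_eqI[rotated]) simp
    qed (auto simp: iff)
  qed
qed

lemma closed_pullback_snd:
  fixes F :: "('a::topological_space \<times> (nat \<Rightarrow> real)) set"
  assumes "closed F" "continuous_on UNIV h"
  shows "closed {p :: 'a \<times> 'c::topological_space. (fst p, h (snd p)) \<in> F}"
proof -
  have "continuous_on UNIV (\<lambda>p :: 'a \<times> 'c. (fst p, h (snd p)))"
    by (intro continuous_intros continuous_on_compose2[OF assms(2)]) auto
  then show ?thesis using closed_vimage[OF assms(1)] by (simp add: vimage_def)
qed

text \<open>Coordinate 0 of a witness names the index \<open>n\<close>; the shifted sequence is a
  witness for \<open>C n\<close>.\<close>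

lemma analytic_UN:
  fixes C :: "nat \<Rightarrow> 'a::topological_space set"
  assumes "\<And>n. analytic (C n)" shows "analytic (\<Union>n. C n)"
proof -
  obtain F :: "nat \<Rightarrow> ('a \<times> (nat \<Rightarrow> real)) set" where F: "\<And>n. closed (F n)" "\<And>n. C n = fst ` F n"
    using assms unfolding analytic_def by metis
  \<comment> \<open>Among natural numbers, distance at least 1 is the closed form of being different
    from \<open>n\<close>.\<close>
  let ?G = "{p. snd p 0 \<in> \<nat> \<and>
    (\<forall>n. 1 \<le> \<bar>snd p 0 - real n\<bar> \<or> (fst p, (\<lambda>k. snd p (Suc k))) \<in> F n)}"
  have c0: "continuous_on UNIV (\<lambda>p :: 'a \<times> (nat \<Rightarrow> real). snd p 0)"
    by (rule continuous_on_product_then_coordinatewise) (intro continuous_on_snd continuous_on_id)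
  have "closed {p :: 'a \<times> (nat \<Rightarrow> real). snd p 0 \<in> \<nat>}"
    using closed_vimage[OF closed_Nats c0] by (simp add: vimage_def)
  moreover have "closed {p :: 'a \<times> (nat \<Rightarrow> real). 1 \<le> \<bar>snd p 0 - real n\<bar>}" for n
    by (intro closed_Collect_le continuous_intros c0)
  moreover have "closed {p. (fst p, (\<lambda>k. snd p (Suc k))) \<in> F n}" for n
    by (rule closed_pullback_snd[OF F(1), of "\<lambda>w k. w (Suc k)"])
      (intro continuous_on_coordinatewise_then_product continuous_on_product_coordinates)
  ultimately have "closed ?G"
    by (intro closed_Collect_conj closed_Collect_all closed_Collect_disj)
  moreover have "(\<Union>n. C n) = fst ` ?G"
  proof (intro set_eqI iffI)
    fix x assume "x \<in> (\<Union>n. C n)"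
    then obtain n w where w: "(x, w) \<in> F n" using F(2) by auto
    have "m = n" if "\<not> 1 \<le> \<bar>real n - real m\<bar>" for m using that by linarith
    then have "(x, case_nat (real n) w) \<in> ?G" using w by auto
    then show "x \<in> fst ` ?G" by (rule image_eqI[rotated]) simp
  next
    fix x assume "x \<in> fst ` ?G"
    then obtain w where w: "(x, w) \<in> ?G" by auto
    then obtain n where "w 0 = real n" by (auto elim: Nats_cases)
    then have "(x, (\<lambda>k. w (Suc k))) \<in> F n" using w by (auto dest: spec[of _ n])
    then show "x \<in> (\<Union>n. C n)" using F(2) by force
  qed
  ultimately show ?thesis by (rule analyticI)
qed

text \<open>One sequence codes a witness for every \<open>C n\<close> at once through
  \<open>prod_encode\<close>.\<close>

lemma analytic_INT:
  fixes C :: "nat \<Rightarrow> 'a::topological_space set"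
  assumes "\<And>n. analytic (C n)" shows "analytic (\<Inter>n. C n)"
proof -
  obtain F :: "nat \<Rightarrow> ('a \<times> (nat \<Rightarrow> real)) set" where F: "\<And>n. closed (F n)" "\<And>n. C n = fst ` F n"
    using assms unfolding analytic_def by metis
  let ?G = "{p. \<forall>n. (fst p, (\<lambda>k. snd p (prod_encode (n, k)))) \<in> F n}"
  have "closed ?G"
    by (intro closed_Collect_all closed_pullback_snd[OF F(1), of "\<lambda>w k. w (prod_encode (_, k))"]
      continuous_on_coordinatewise_then_product continuous_on_product_coordinates)
  moreover have "(\<Inter>n. C n) = fst ` ?G"
  proof (intro set_eqI iffI)
    fix x assume "x \<in> (\<Inter>n. C n)"
    then have "\<forall>n. \<exists>w. (x, w) \<in> F n" using F(2) by force
    then obtain w where w: "\<And>n. (x, w n) \<in> F n" by metis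
    then have "(x, \<lambda>j. case prod_decode j of (n, k) \<Rightarrow> w n k) \<in> ?G" by simp
    then show "x \<in> fst ` ?G" by (rule image_eqI[rotated]) simp
  next
    fix x assume "x \<in> fst ` ?G"
    then obtain w where "\<And>n. (x, (\<lambda>k. w (prod_encode (n, k)))) \<in> F n" by auto
    then show "x \<in> (\<Inter>n. C n)" using F(2) by force
  qed
  ultimately show ?thesis by (rule analyticI)
qed

text \<open>The induction carries the set together with its complement: complementation then only
  swaps the two claims, and unions become intersections.\<close>

lemma borel_imp_analytic:
  fixes C :: "'a::metric_space set"
  assumes "C \<in> sets borel" shows "analytic C"
proof -
  have "C \<in> sigma_sets UNIV {S :: 'a set. open S}"
    using assms by (simp add: borel_def)
  then have "analytic C \<and> analytic (- C)"
  proof induction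
    case (Basic a)
    then show ?case by (auto intro: open_imp_analytic closed_imp_analytic)
  next
    case Empty
    then show ?case by (auto intro: closed_imp_analytic)
  next
    case (Compl a)
    then show ?case by (simp add: Compl_eq_Diff_UNIV[symmetric])
  next
    case (Union a)
    then show ?case by (auto intro: analytic_UN analytic_INT simp: Compl_UN)
  qed
  then show ?thesis ..
qed

section \<open>Counting: codes for analytic sets and the perfect set theorem\<close>

lemma analytic_sets_coding:
  obtains \<Theta> :: "(nat \<Rightarrow> bool) \<Rightarrow> 'a::second_countable_topology set"
  where "\<And>C. analytic C \<Longrightarrow> C \<in> range \<Theta>"
proof -
  obtain B :: "('a \<times> (nat \<Rightarrow> real)) set set" where B: "countable B" "topological_basis B"
    using ex_countable_basis by blast
  \<comment> \<open>A closed set is determined by the basic sets that miss it; \<open>p\<close>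
    lists their indices.\<close>
  define \<Theta> where "\<Theta> p = fst ` (- (\<Union>{from_nat_into B n |n. p n}))" for p
  have "C \<in> range \<Theta>" if C: "analytic C" for C
  proof -
    obtain F :: "('a \<times> (nat \<Rightarrow> real)) set" where F: "closed F" "C = fst ` F"
      using C unfolding analytic_def by blast
    from F(1) have "open (- F)" by (rule open_Compl)
    then obtain B' where B': "B' \<subseteq> B" "\<Union>B' = - F"
      using B(2) unfolding topological_basis_def by blast
    have "{from_nat_into B n |n. from_nat_into B n \<in> B'} = B'"
      using B' from_nat_into_surj[OF B(1)] by fastforce
    then have "C = \<Theta> (\<lambda>n. from_nat_into B n \<in> B')" using B'(2) F(2) by (simp add: \<Theta>_def)
    then show ?thesis by simp
  qed
  then show thesis by (rule that)
qed

text \<open>A Cantor scheme: open sets indexed by finite bit strings shrink along each branch and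
  have disjoint \<open>p\<close>-images at each splitting.\<close>

lemma perfect_subset:
  fixes p :: "'a::{complete_space,second_countable_topology} \<Rightarrow> 'b::metric_space"
  assumes "closed K" and p: "continuous_on UNIV p" and unc: "uncountable (p ` K)"
  obtains c :: "(nat \<Rightarrow> bool) \<Rightarrow> 'a" where "range c \<subseteq> K" "inj (p \<circ> c)"
proof -
  obtain B :: "'a set set" where B: "countable B" "topological_basis B"
    using ex_countable_basis by blast
  define big where "big U \<longleftrightarrow> open U \<and> uncountable (p ` (K \<inter> U))" for U
  \<comment> \<open>Removing \<open>E\<close> loses only countably many values, and every basic set
    containing a point of \<open>K\<close> outside \<open>E\<close> is big.\<close>
  define E where "E = \<Union>{V \<in> B. \<not> big V}"
  have opB: "open V" if "V \<in> B" for V using topological_basis_open[OF B(2) that] .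
  have "p ` (K \<inter> E) = (\<Union>V\<in>{V \<in> B. \<not> big V}. p ` (K \<inter> V))"
    unfolding E_def by blast
  moreover have "countable \<dots>"
    using B(1) opB by (intro countable_UN) (auto simp: big_def)
  ultimately have cE: "countable (p ` (K \<inter> E))" by simp
  define step where "step U i V \<longleftrightarrow> (\<forall>b. big (V b) \<and> closure (V b) \<subseteq> U \<and>
    (\<forall>x\<in>V b. \<forall>y\<in>V b. dist x y < 1 / Suc i)) \<and> p ` V False \<inter> p ` V True = {}"
    for U :: "'a set" and i :: nat and V :: "bool \<Rightarrow> 'a set"
  have ex: "\<exists>V. step U i V" if "big U" for U i
  proof -
    have "p ` (K \<inter> U) \<subseteq> p ` (K \<inter> E) \<union> p ` (K \<inter> U - E)" by blast
    then have "uncountable (p ` (K \<inter> U - E))"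
      using \<open>big U\<close> cE unfolding big_def by (meson countable_Un countable_subset)
    then have nsub: "\<not> p ` (K \<inter> U - E) \<subseteq> {v}" for v
      by (metis countable_empty countable_insert countable_subset)
    from nsub obtain x where x: "x \<in> K \<inter> U - E" by blast
    from nsub[of "p x"] obtain v where "v \<in> p ` (K \<inter> U - E)" "v \<noteq> p x" by blast
    then obtain y where y: "y \<in> K \<inter> U - E" "p x \<noteq> p y" by (elim imageE) simp
    define z where "z b = (if b then y else x)" for b
    have z: "z b \<in> K \<inter> U - E" "p (z False) \<noteq> p (z True)" for b
      using x y by (simp_all add: z_def)
    \<comment> \<open>Separating the two values, rather than the two points, is what makes
      \<open>p \<circ> c\<close> injective.\<close>
    obtain S0 S1 where S: "open S0" "open S1" "p (z False) \<in> S0" "p (z True) \<in> S1" "S0 \<inter> S1 = {}"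
      using hausdorff[OF z(2)] by blast
    define S where "S b = (if b then S1 else S0)" for b
    have "\<exists>V\<in>B. z b \<in> V \<and> closure V \<subseteq> U \<inter> p -` S b \<and> (\<forall>x\<in>V. \<forall>y\<in>V. dist x y < 1 / Suc i)" for b
    proof (rule shrinking_basis_element[OF B(2), of "U \<inter> p -` S b" "z b" "1 / Suc i"])
      show "open (U \<inter> p -` S b)"
        using \<open>big U\<close> S(1,2) p by (auto simp: big_def S_def intro!: open_Int open_vimage)
      show "z b \<in> U \<inter> p -` S b" using z(1)[of b] S(3,4) by (cases b) (auto simp: S_def)
    qed auto
    then obtain V where V: "\<And>b. V b \<in> B" "\<And>b. z b \<in> V b" "\<And>b. closure (V b) \<subseteq> U \<inter> p -` S b"
      "\<And>b. \<forall>x\<in>V b. \<forall>y\<in>V b. dist x y < 1 / Suc i"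
      by metis
    have "big (V b)" for b using V(1,2) z(1) unfolding E_def by blast
    moreover have "p ` V b \<subseteq> S b" for b using V(3)[of b] closure_subset[of "V b"] by blast
    then have "p ` V False \<inter> p ` V True = {}" using S(5) unfolding S_def by fastforce
    ultimately have "step U i V" using V(3,4) unfolding step_def by blast
    then show ?thesis by blast
  qed
  define st where "st = rec_list UNIV (\<lambda>b s U. (SOME V. step U (length s) V) b)"
  have st_Nil: "st [] = UNIV" and st_Cons: "st (b # s) = (SOME V. step (st s) (length s) V) b" for b s
    by (simp_all add: st_def)
  have st_step: "step (st s) (length s) (\<lambda>b. st (b # s))" if "big (st s)" for s
    unfolding st_Cons by (rule someI_ex[OF ex[OF that]])
  have big_st: "big (st s)" for s
  proof (induction s)
    case Nil
    then show ?case using unc by (simp add: st_Nil big_def)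
  next
    case (Cons b s)
    then show ?case using st_step unfolding step_def by blast
  qed
  define pre where "pre a = rec_nat [] (\<lambda>i t. a i # t)" for a :: "nat \<Rightarrow> bool"
  have pre_0: "pre a 0 = []" and pre_Suc: "pre a (Suc i) = a i # pre a i" for a i
    by (simp_all add: pre_def)
  have len: "length (pre a i) = i" for a i by (induction i) (simp_all add: pre_0 pre_Suc)
  have step': "step (st (pre a i)) i (\<lambda>b. st (b # pre a i))" for a i
    using st_step[OF big_st, of "pre a i"] by (simp add: len)
  have "\<exists>z. z \<in> K \<and> (\<forall>i. z \<in> st (pre a i))" for a
  proof (rule nested_sets_limit[OF \<open>closed K\<close>, of "\<lambda>i. st (pre a i)"])
    show "K \<inter> st (pre a i) \<noteq> {}" for i
      using big_st[of "pre a i"] unfolding big_def by force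
    show "closure (st (pre a (Suc i))) \<subseteq> st (pre a i)" for i
      using step'[of a i] by (simp add: step_def pre_Suc)
    show "dist x y < 1 / Suc i" if "x \<in> st (pre a (Suc i))" "y \<in> st (pre a (Suc i))" for i x y
      using step'[of a i] that by (simp add: step_def pre_Suc)
  qed blast
  then obtain c where c: "\<And>a. c a \<in> K" "\<And>a i. c a \<in> st (pre a i)" by metis
  have "inj (p \<circ> c)"
  proof (rule injI, rule ccontr)
    fix a a' assume eq: "(p \<circ> c) a = (p \<circ> c) a'" and "a \<noteq> a'"
    then have "\<exists>i. a i \<noteq> a' i" by auto
    \<comment> \<open>Up to the first difference \<open>n\<close> both branches share the prefix
      \<open>pre a n\<close>; there they enter sets with disjoint images.\<close>
    define n where "n = (LEAST i. a i \<noteq> a' i)"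
    have n: "a n \<noteq> a' n" unfolding n_def by (rule LeastI_ex) fact
    have less: "a i = a' i" if "i < n" for i
      using not_less_Least[OF that[unfolded n_def]] by simp
    have "i \<le> n \<Longrightarrow> pre a i = pre a' i" for i
      by (induction i) (auto simp: pre_0 pre_Suc less)
    then have "pre a' n = pre a n" by simp
    then have "c a \<in> st (a n # pre a n)" "c a' \<in> st (a' n # pre a n)"
      using c(2)[of a "Suc n"] c(2)[of a' "Suc n"] by (simp_all add: pre_Suc)
    then have "p (c a) \<in> p ` st (a n # pre a n)" "p (c a') \<in> p ` st (a' n # pre a n)"
      by simp_all
    moreover have "p (c a) = p (c a')" using eq by simp
    moreover have "p ` st (False # pre a n) \<inter> p ` st (True # pre a n) = {}"
      using step'[of a n] by (simp add: step_def)
    ultimately show False using n by (cases "a n"; cases "a' n") auto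
  qed
  with c(1) that show thesis by blast
qed

subsection \<open>Borel functions into metric spaces\<close>

text \<open>The graph of \<open>r\<close> is Borel, so an uncountable range would contain an
  injective copy of Cantor space. Every subset of the copy has a Borel preimage, hence a code in
  Cantor space, which a diagonal set refutes.\<close>

lemma countable_range_if_all_vimages_borel:
  fixes r :: "'a::{complete_space,second_countable_topology} \<Rightarrow> 'b::{complete_space,second_countable_topology}"
  assumes r: "\<And>A. r -` A \<in> sets borel"
  shows "countable (range r)"
proof (rule ccontr)
  assume unc: "uncountable (range r)"
  have [measurable]: "r \<in> borel_measurable borel" using r by (auto intro!: measurableI)
  have [measurable]: "fst \<in> borel_measurable (borel :: ('a \<times> 'b) measure)"
    "snd \<in> borel_measurable (borel :: ('a \<times> 'b) measure)"
    by (intro borel_measurable_continuous_onI continuous_intros)+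
  have "(\<lambda>q :: 'a \<times> 'b. dist (r (fst q)) (snd q)) \<in> borel_measurable borel"
    by measurable
  then have "(\<lambda>q :: 'a \<times> 'b. dist (r (fst q)) (snd q)) -` {0} \<inter> space borel \<in> sets borel"
    by (rule measurable_sets) simp
  then have "analytic {q :: 'a \<times> 'b. r (fst q) = snd q}"
    by (intro borel_imp_analytic) (simp add: vimage_def)
  then obtain F :: "(('a \<times> 'b) \<times> (nat \<Rightarrow> real)) set"
    where F: "closed F" "{q. r (fst q) = snd q} = fst ` F"
    unfolding analytic_def by blast
  define p where "p = (\<lambda>u :: ('a \<times> 'b) \<times> (nat \<Rightarrow> real). snd (fst u))"
  have p: "continuous_on UNIV p" unfolding p_def by (intro continuous_intros)
  have "p ` F = snd ` {q. r (fst q) = snd q}"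
    unfolding F(2) p_def by (simp add: image_image)
  also have "\<dots> = range r" by (auto simp: image_def)
  finally have pF: "p ` F = range r" .
  with unc have "uncountable (p ` F)" by simp
  then obtain c :: "(nat \<Rightarrow> bool) \<Rightarrow> ('a \<times> 'b) \<times> (nat \<Rightarrow> real)"
    where c: "range c \<subseteq> F" "inj (p \<circ> c)"
    using perfect_subset[OF F(1) p] by blast
  obtain \<Theta> :: "(nat \<Rightarrow> bool) \<Rightarrow> 'a set" where \<Theta>: "\<And>C. analytic C \<Longrightarrow> C \<in> range \<Theta>"
    using analytic_sets_coding by blast
  have in_r: "(p \<circ> c) b \<in> range r" for b using c(1) pF by auto
  \<comment> \<open>Cantor's diagonal set, transported to the range of \<open>r\<close>\<close>
  let ?D = "{q. (p \<circ> c) q \<notin> r ` \<Theta> q}"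
  have "r -` ((p \<circ> c) ` ?D) \<in> range \<Theta>"
    using r by (intro \<Theta> borel_imp_analytic)
  then obtain q where "\<Theta> q = r -` ((p \<circ> c) ` ?D)" by auto
  \<comment> \<open>The copy lies in the range of \<open>r\<close>, so \<open>r\<close> maps the
    preimage back onto the diagonal set.\<close>
  then have "r ` \<Theta> q = (p \<circ> c) ` ?D" using in_r by auto
  then have "q \<in> ?D \<longleftrightarrow> (p \<circ> c) q \<notin> (p \<circ> c) ` ?D" by simp
  also have "\<dots> \<longleftrightarrow> q \<notin> ?D" by (simp only: inj_image_mem_iff[OF c(2)])
  finally show False by blast
qed

text \<open>Zorn's lemma on the \<open>e\<close>-separated subsets: a point at distance at least
  \<open>e\<close> from a maximal one could be added to it.\<close>

lemma maximal_separated_set: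
  fixes S :: "'a::metric_space set"
  obtains D where "D \<subseteq> S" "\<And>x y. x \<in> D \<Longrightarrow> y \<in> D \<Longrightarrow> dist x y < e \<Longrightarrow> x = y"
    "\<And>x. x \<in> S \<Longrightarrow> 0 < e \<Longrightarrow> \<exists>d\<in>D. dist x d < e"
proof -
  let ?A = "{D. D \<subseteq> S \<and> (\<forall>x\<in>D. \<forall>y\<in>D. dist x y < e \<longrightarrow> x = y)}"
  have "\<Union>C \<in> ?A" if "subset.chain ?A C" for C
  proof -
    have "x = y" if xy: "x \<in> X" "X \<in> C" "y \<in> Y" "Y \<in> C" "dist x y < e" for x y X Y
    proof -
      have "X \<subseteq> Y \<or> Y \<subseteq> X" using \<open>subset.chain ?A C\<close> xy by (auto simp: subset_chain_def)
      then have "\<exists>Z\<in>C. x \<in> Z \<and> y \<in> Z" using xy by blast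
      moreover have "C \<subseteq> ?A" using \<open>subset.chain ?A C\<close> by (simp add: subset_chain_def)
      ultimately show ?thesis using xy(5) by blast
    qed
    moreover have "\<Union>C \<subseteq> S" using that by (auto simp: subset_chain_def)
    ultimately show ?thesis by blast
  qed
  then have "\<exists>D\<in>?A. \<forall>X\<in>?A. D \<subseteq> X \<longrightarrow> X = D" by (rule subset_Zorn')
  then obtain D where D: "D \<in> ?A" "\<forall>X\<in>?A. D \<subseteq> X \<longrightarrow> X = D" by (rule bexE)
  have "\<exists>d\<in>D. dist x d < e" if "x \<in> S" "0 < e" for x
  proof (rule ccontr)
    assume far: "\<not> (\<exists>d\<in>D. dist x d < e)"
    then have "insert x D \<in> ?A" using D(1) that by (auto simp: dist_commute)
    with D(2) have "insert x D = D" by (meson subset_insertI)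
    then have "x \<in> D" by blast
    then show False using far that by auto
  qed
  with D(1) that[of D] show thesis by simp
qed

text \<open>For each \<open>e\<close>, a maximal \<open>e\<close>-separated subset of the range is
  countable, since all its subsets are closed and so have Borel preimages. The union over
  \<open>e = 1 / Suc n\<close> is dense in the range.\<close>

lemma borel_measurable_range_separable:
  fixes g :: "'a::{complete_space,second_countable_topology} \<Rightarrow> 'b::metric_space"
  assumes g: "g \<in> borel_measurable borel"
  obtains D where "countable D" "range g \<subseteq> closure D"
proof -
  have "\<exists>D. countable D \<and> (\<forall>x. \<exists>d\<in>D. dist (g x) d < e)" if "e > 0" for e
  proof -
    obtain D where D: "D \<subseteq> range g" "\<And>x y. x \<in> D \<Longrightarrow> y \<in> D \<Longrightarrow> dist x y < e \<Longrightarrow> x = y"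
      "\<And>x. x \<in> range g \<Longrightarrow> 0 < e \<Longrightarrow> \<exists>d\<in>D. dist x d < e"
      using maximal_separated_set[of "range g" e] by blast
    have cl: "closed E" if "E \<subseteq> D" for E
      using D(2) that \<open>e > 0\<close> by (intro discrete_imp_closed[of e]) blast+
    have gE: "g -` E \<in> sets borel" if "E \<subseteq> D" for E
      using measurable_sets[OF g borel_closed[OF cl[OF that]]] by simp
    define h where "h y = (SOME x. g x = y)" for y
    have gh: "g (h y) = y" if "y \<in> D" for y
      unfolding h_def using D(1) that by (auto intro: someI)
    \<comment> \<open>Choosing preimages moves \<open>D\<close> into the domain, which is complete
      and second countable; points not mapped into \<open>D\<close> share the default
      \<open>undefined\<close>.\<close>
    define r where "r x = (if g x \<in> D then h (g x) else undefined)" for x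
    have "r -` A = g -` {y \<in> D. h y \<in> A} \<union> (if undefined \<in> A then - (g -` D) else {})" for A
      by (auto simp: r_def split: if_splits)
    then have "r -` A \<in> sets borel" for A
      using gE[of "{y \<in> D. h y \<in> A}"] gE[of D] by (auto intro: borel_comp)
    then have "countable (range r)" by (rule countable_range_if_all_vimages_borel)
    moreover have "D \<subseteq> g ` range r"
    proof
      fix y assume "y \<in> D"
      then have "r (h y) = h y" by (simp add: r_def gh)
      then show "y \<in> g ` range r" using gh[OF \<open>y \<in> D\<close>] by (metis rangeI image_eqI)
    qed
    ultimately have "countable D" by (meson countable_image countable_subset)
    with D(3) \<open>e > 0\<close> show ?thesis by blast
  qed
  then have "\<forall>n. \<exists>D. countable D \<and> (\<forall>x. \<exists>d\<in>D. dist (g x) d < 1 / Suc n)" by simp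
  then obtain D where D: "\<And>n. countable (D n)" "\<And>n x. \<exists>d\<in>D n. dist (g x) d < 1 / Suc n"
    by metis
  have "g x \<in> closure (\<Union>n. D n)" for x
    unfolding closure_approachable
  proof (intro allI impI)
    fix e :: real assume "0 < e"
    then obtain n where "1 / Suc n < e" using nat_approx_posE by blast
    moreover obtain d where "d \<in> D n" "dist (g x) d < 1 / Suc n" using D(2) by blast
    ultimately show "\<exists>y\<in>\<Union>n. D n. dist y (g x) < e" by (auto simp: dist_commute intro: less_trans)
  qed
  then show thesis using that[of "\<Union>n. D n"] D(1) by blast
qed

text \<open>With a countable \<open>D\<close> dense in the range of \<open>g\<close>, the condition
  \<open>dist (f x) (g x) < t\<close> splits into countably many conditions on distances to single
  points of \<open>D\<close>.\<close>

lemma borel_measurable_dist_polish_domain: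
  fixes f g :: "'a::{complete_space,second_countable_topology} \<Rightarrow> 'b::metric_space"
  assumes f: "f \<in> borel_measurable borel" and g: "g \<in> borel_measurable borel"
  shows "(\<lambda>x. dist (f x) (g x)) \<in> borel_measurable borel"
proof -
  obtain D where D: "countable D" "range g \<subseteq> closure D"
    using borel_measurable_range_separable[OF g] by blast
  have m: "{x. dist (h x) d < t} \<in> sets borel"
    if "h \<in> borel_measurable borel" for h :: "'a \<Rightarrow> 'b" and d t
  proof -
    have "h -` ball d t \<inter> space borel \<in> sets borel"
      by (rule measurable_sets[OF that]) simp
    then show ?thesis by (simp add: vimage_def ball_def dist_commute)
  qed
  have "{x. dist (f x) (g x) < t} \<in> sets borel" for t
  proof -
    have "{x. dist (f x) (g x) < t} =
      (\<Union>d\<in>D. \<Union>q\<in>\<rat>. {x. dist (f x) d < q} \<inter> {x. dist (g x) d < t - q})"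
    proof (intro set_eqI iffI)
      fix x assume "x \<in> {x. dist (f x) (g x) < t}"
      then have pos: "0 < (t - dist (f x) (g x)) / 2" by simp
      obtain d where d: "d \<in> D" "dist d (g x) < (t - dist (f x) (g x)) / 2"
        using D(2) pos unfolding closure_approachable[of "g x" D, symmetric]
        by (meson closure_approachable rangeI subsetD)
      have "dist (f x) d < t - dist (g x) d"
        using d(2) dist_triangle[of "f x" d "g x"] by (simp add: dist_commute field_simps)
      then obtain q where "q \<in> \<rat>" "dist (f x) d < q" "q < t - dist (g x) d"
        using Rats_dense_in_real by blast
      then show "x \<in> (\<Union>d\<in>D. \<Union>q\<in>\<rat>. {x. dist (f x) d < q} \<inter> {x. dist (g x) d < t - q})"
        using d(1) by force
    next
      fix x assume "x \<in> (\<Union>d\<in>D. \<Union>q\<in>\<rat>. {x. dist (f x) d < q} \<inter> {x. dist (g x) d < t - q})"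
      then obtain d q where "dist (f x) d < q" "dist (g x) d < t - q" by auto
      then show "x \<in> {x. dist (f x) (g x) < t}"
        using dist_triangle2[of "f x" "g x" d] by simp
    qed
    also have "\<dots> \<in> sets borel"
      using D(1) by (intro sets.countable_UN'' sets.Int m f g countable_rat) auto
    finally show ?thesis .
  qed
  then show ?thesis by (simp add: borel_measurable_iff_less)
qed

subsection \<open>Convergence along selective ultrafilters\<close>

text \<open>Attach to \<open>x\<close> a witness and a real switch for every index. A positive
  switch is an open condition, while "switch at most 0 or witness valid" is closed, as
  \<open>selective_almost_disjoint\<close> requires.\<close>

lemma selective_point_finite:
  fixes \<alpha> :: "nat filter" and C :: "nat \<Rightarrow> 'a::{complete_space,second_countable_topology} set"
  assumes np: "nonprincipal_ultrafilter \<alpha>" and sel: "selective \<alpha>"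
    and C: "\<And>n. analytic (C n)" and null: "\<And>x. \<forall>\<^sub>F n in \<alpha>. x \<notin> C n"
  obtains N where "\<forall>\<^sub>F n in \<alpha>. n \<in> N" "\<And>x. finite {n \<in> N. x \<in> C n}"
proof -
  have u: "ultrafilter \<alpha>" using np by (simp add: nonprincipal_ultrafilter_def)
  obtain F :: "nat \<Rightarrow> ('a \<times> (nat \<Rightarrow> real)) set" where F: "\<And>n. closed (F n)" "\<And>n. C n = fst ` F n"
    using C unfolding analytic_def by metis
  \<comment> \<open>a point \<open>(x, w, e)\<close>: where \<open>e n > 0\<close>, \<open>w n\<close> witnesses \<open>x \<in> C n\<close>\<close>
  define K where "K = {p :: 'a \<times> ((nat \<Rightarrow> nat \<Rightarrow> real) \<times> (nat \<Rightarrow> real)).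
    \<forall>n. snd (snd p) n \<le> 0 \<or> (fst p, fst (snd p) n) \<in> F n}"
  define \<phi> where "\<phi> p = {n. 0 < snd (snd p) n}"
    for p :: "'a \<times> ((nat \<Rightarrow> nat \<Rightarrow> real) \<times> (nat \<Rightarrow> real))"
  have c: "continuous_on UNIV (\<lambda>p :: 'a \<times> ((nat \<Rightarrow> nat \<Rightarrow> real) \<times> (nat \<Rightarrow> real)). snd (snd p) n)" for n
    by (rule continuous_on_product_then_coordinatewise) (intro continuous_on_snd continuous_on_id)
  have "continuous_on UNIV (\<lambda>v :: (nat \<Rightarrow> nat \<Rightarrow> real) \<times> (nat \<Rightarrow> real). fst v n)" for n
    by (rule continuous_on_product_then_coordinatewise) (intro continuous_on_fst continuous_on_id)
  note cl = closed_pullback_snd[OF F(1) this]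
  have "closed K"
    unfolding K_def
    by (intro closed_Collect_all closed_Collect_disj closed_Collect_le c continuous_on_const cl)
  moreover have "open {p. n \<in> \<phi> p}" for n
    unfolding \<phi>_def mem_Collect_eq by (intro open_Collect_less continuous_on_const c)
  moreover have "\<not> (\<forall>\<^sub>F n in \<alpha>. n \<in> \<phi> p)" if "p \<in> K" for p
  proof -
    have "\<phi> p \<subseteq> {n. fst p \<in> C n}"
      using that unfolding K_def \<phi>_def F(2) by (force simp: not_le[symmetric])
    then have "\<forall>\<^sub>F n in \<alpha>. n \<notin> \<phi> p"
      by (intro eventually_mono[OF null[of "fst p"]]) auto
    then show ?thesis using ultrafilter_not_eventually[OF u] by blast
  qed
  ultimately obtain N where N: "\<forall>\<^sub>F n in \<alpha>. n \<in> N" "\<And>p. p \<in> K \<Longrightarrow> finite (N \<inter> \<phi> p)"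
    using selective_almost_disjoint[OF np sel, of K \<phi>] by blast
  have "finite {n \<in> N. x \<in> C n}" for x
  proof -
    have "\<forall>n. \<exists>w. x \<in> C n \<longrightarrow> (x, w) \<in> F n" using F(2) by force
    then obtain w where w: "\<And>n. x \<in> C n \<Longrightarrow> (x, w n) \<in> F n" by metis
    \<comment> \<open>\<open>w n\<close> is arbitrary when \<open>x\<close> is not in
      \<open>C n\<close>; the switch value 0 keeps the point in \<open>K\<close> there.\<close>
    let ?p = "(x, w, \<lambda>n. if x \<in> C n then 1 else 0)"
    have "?p \<in> K" using w by (auto simp: K_def)
    moreover have "{n \<in> N. x \<in> C n} = N \<inter> \<phi> ?p" by (auto simp: \<phi>_def)
    ultimately show ?thesis using N(2) by metis
  qed
  with N(1) that show thesis by blast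
qed

theorem theorem20:
  fixes \<alpha> :: "nat filter"
    and f :: "nat \<Rightarrow> 'a::polish_space \<Rightarrow> 'b::metric_space"
    and g :: "'a \<Rightarrow> 'b"
  assumes "nonprincipal_ultrafilter \<alpha>"
    and "\<And>n. f n \<in> borel_measurable borel"
    and "g \<in> borel_measurable borel"
    and "\<And>x. ((\<lambda>n. f n x) \<longlongrightarrow> g x) \<alpha>"
    and "selective \<alpha>"
  shows "\<exists>N. (\<forall>\<^sub>F n in \<alpha>. n \<in> N) \<and>
           (\<forall>x. ((\<lambda>n. f n x) \<longlongrightarrow> g x) (inf sequentially (principal N)))"
proof -
  define C where "C k n = {x. 1 / Suc k \<le> dist (f n x) (g x)}" for k n
  have "analytic (C k n)" for k n
  proof (rule borel_imp_analytic)
    have [measurable]: "(\<lambda>x. dist (f n x) (g x)) \<in> borel_measurable borel"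
      by (rule borel_measurable_dist_polish_domain[OF assms(2,3)])
    show "C k n \<in> sets borel" unfolding C_def by measurable
  qed
  moreover have "\<forall>\<^sub>F n in \<alpha>. x \<notin> C k n" for k x
    using tendstoD[OF assms(4), of "1 / Suc k"] by (simp add: C_def not_le)
  ultimately have "\<forall>k. \<exists>N. (\<forall>\<^sub>F n in \<alpha>. n \<in> N) \<and> (\<forall>x. finite {n \<in> N. x \<in> C k n})"
    using selective_point_finite[OF assms(1,5)] by metis
  then obtain M where M: "\<And>k. \<forall>\<^sub>F n in \<alpha>. n \<in> M k" "\<And>k x. finite {n \<in> M k. x \<in> C k n}"
    by metis
  obtain N where N: "\<forall>\<^sub>F n in \<alpha>. n \<in> N" "\<And>k. finite (N - M k)"
    by (rule selective_pseudo_intersection[where B = M, OF assms(1,5) M(1)]) blast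
  have "((\<lambda>n. f n x) \<longlongrightarrow> g x) (inf sequentially (principal N))" for x
  proof (rule tendstoI)
    fix e :: real assume "0 < e"
    then obtain k where k: "1 / Suc k < e" using nat_approx_posE by blast
    \<comment> \<open>The exceptions along \<open>N\<close> are finitely many outside
      \<open>M k\<close> and finitely many inside it.\<close>
    have "{n \<in> N. x \<in> C k n} \<subseteq> (N - M k) \<union> {n \<in> M k. x \<in> C k n}" by auto
    then have "finite {n \<in> N. x \<in> C k n}"
      by (rule finite_subset) (simp add: N(2) M(2))
    then have "\<forall>\<^sub>F n in sequentially. n \<notin> {n \<in> N. x \<in> C k n}"
      by (simp add: eventually_cofinite flip: cofinite_eq_sequentially)
    then show "\<forall>\<^sub>F n in inf sequentially (principal N). dist (f n x) (g x) < e"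
      unfolding eventually_inf_principal
      by (rule eventually_mono) (use k in \<open>auto simp: C_def not_le intro: less_trans\<close>)
  qed
  with N(1) show ?thesis by blast
qed

end
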